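(* Let $G$ be a finite directed multigraph without loops on vertex set $\{1,\dots,n+1\}$ having a global sink at vertex $n+1$, with reduced Laplacian $\Delta$. Let $\mathbf a^*$ be a critical configuration. Then for every stable configuration $\mathbf a$ linearly equivalent to $\mathbf a^*$ we have $\mathbf a\preceq_{\mathrm{CFG}}\mathbf a^*$, i.e. $\mathbf a\Delta^{-1}\preceq\mathbf a^*\Delta^{-1}$ componentwise; moreover the inequality is strict ($\mathbf a\Delta^{-1}\ne\mathbf a^*\Delta^{-1}$) when $\mathbf a\ne\mathbf a^*$. In other words, the critical configuration is the greatest element, with respect to $\preceq_{\mathrm{CFG}}$ (equivalently, the greatest energy vector in the containment order), among the stable configurations of its equivalence class.
   Context: $G=(V,E)$ is a directed multigraph without loops, $V=\{1,\dots,n+1\}$; $d^+_i$ is the out-degree of $i$ and $e_{i,j}$ the number of edges from $i$ to $j$. Vertex $n+1$ is a global sink: it has no out-going edges and every other vertex has a directed path to it. The reduced Laplacian $\Delta\in\mathbb Z^{n\times n}$ has $\Delta_{ii}=d^+_i$ and $\Delta_{ij}=-e_{i,j}$ for $i\ne j$ ($i,j\le n$); it is invertible. $\Delta_i$ is its $i$-th row. Vectors are row vectors. A configuration is a vector in $\mathbb Z^n$. Two configurations $\mathbf a,\mathbf b$ are linearly equivalent if $\mathbf b=\mathbf a-\sigma\Delta$ for some $\sigma\in\mathbb Z^n$. Vertex $i$ is active in $\mathbf a$ if $a_i\ge d^+_i$; firing it gives $\mathbf a-\Delta_i$. A firing sequence is legal if each fired vertex is active when it fires. A stable configuration is a non-negative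 configuration with no active vertex. For non-negative $\mathbf a$, $\mathbf a^\circ$ denotes the unique stable configuration reachable from $\mathbf a$ by a legal firing sequence. A non-negative configuration $\mathbf a$ is critical if for every configuration $\mathbf b$ there exists a non-negative configuration $\mathbf c$ with $\mathbf b+\mathbf c$ non-negative and $\mathbf a=(\mathbf b+\mathbf c)^\circ$. Containment order: $a\preceq b$ iff $a_i\le b_i$ for all $i$. The energy vector of a configuration $\mathbf a$ is $\mathbf a\Delta^{-1}$, and $\mathbf a\preceq_{\mathrm{CFG}}\mathbf b$ means $\mathbf a\Delta^{-1}\preceq\mathbf b\Delta^{-1}$. *)

theory Defs
  imports "Graph_Theory.Digraph" "Jordan_Normal_Form.Gauss_Jordan_Elimination"
begin

definition global_sink :: "('v, 'e) pre_digraph \<Rightarrow> 'v \<Rightarrow> bool" where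
  "global_sink G s \<longleftrightarrow> s \<in> verts G \<and> out_arcs G s = {} \<and>
     (\<forall>v \<in> verts G - {s}. v \<rightarrow>\<^sup>*\<^bsub>G\<^esub> s)"

definition edge_mult :: "('v, 'e) pre_digraph \<Rightarrow> 'v \<Rightarrow> 'v \<Rightarrow> nat" where
  "edge_mult G i j = card {e \<in> arcs G. tail G e = i \<and> head G e = j}"

text \<open>The vertices are 1, ..., n+1, whereas the entries of vectors and matrices are numbered
  from 0: vertex \<open>i \<in> {1..n}\<close> owns the coordinate \<open>i - 1\<close>.\<close>

definition reduced_laplacian :: "(nat, 'e) pre_digraph \<Rightarrow> nat \<Rightarrow> int mat" where
  "reduced_laplacian G n = mat n n (\<lambda>(i, j).
     if i = j then int (out_degree G (i + 1)) else - int (edge_mult G (i + 1) (j + 1)))"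

text \<open>Vectors are row vectors, so this is \<open>v A\<close>.\<close>

definition row_vec_mult :: "'a :: comm_semiring_0 vec \<Rightarrow> 'a mat \<Rightarrow> 'a vec" where
  "row_vec_mult v A = transpose_mat A *\<^sub>v v"

definition lin_equiv :: "(nat, 'e) pre_digraph \<Rightarrow> nat \<Rightarrow> int vec \<Rightarrow> int vec \<Rightarrow> bool" where
  "lin_equiv G n a b \<longleftrightarrow> a \<in> carrier_vec n \<and> b \<in> carrier_vec n \<and>
     (\<exists>\<sigma> \<in> carrier_vec n. b = a - row_vec_mult \<sigma> (reduced_laplacian G n))"

definition nonneg_config :: "nat \<Rightarrow> int vec \<Rightarrow> bool" where
  "nonneg_config n a \<longleftrightarrow> a \<in> carrier_vec n \<and> 0\<^sub>v n \<le> a"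

definition active :: "(nat, 'e) pre_digraph \<Rightarrow> int vec \<Rightarrow> nat \<Rightarrow> bool" where
  "active G a i \<longleftrightarrow> a $ (i - 1) \<ge> int (out_degree G i)"

definition fire :: "(nat, 'e) pre_digraph \<Rightarrow> nat \<Rightarrow> int vec \<Rightarrow> nat \<Rightarrow> int vec" where
  "fire G n a i = a - row (reduced_laplacian G n) (i - 1)"

fun legal_seq :: "(nat, 'e) pre_digraph \<Rightarrow> nat \<Rightarrow> int vec \<Rightarrow> nat list \<Rightarrow> bool" where
  "legal_seq G n a [] \<longleftrightarrow> True"
| "legal_seq G n a (i # is) \<longleftrightarrow> i \<in> {1..n} \<and> active G a i \<and> legal_seq G n (fire G n a i) is"

definition legally_reachable :: "(nat, 'e) pre_digraph \<Rightarrow> nat \<Rightarrow> int vec \<Rightarrow> int vec \<Rightarrow> bool" where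
  "legally_reachable G n a b \<longleftrightarrow> (\<exists>is. legal_seq G n a is \<and> b = foldl (fire G n) a is)"

definition stable_config :: "(nat, 'e) pre_digraph \<Rightarrow> nat \<Rightarrow> int vec \<Rightarrow> bool" where
  "stable_config G n a \<longleftrightarrow> nonneg_config n a \<and> (\<forall>i \<in> {1..n}. \<not> active G a i)"

definition stabilization :: "(nat, 'e) pre_digraph \<Rightarrow> nat \<Rightarrow> int vec \<Rightarrow> int vec" where
  "stabilization G n a = (THE s. stable_config G n s \<and> legally_reachable G n a s)"

definition critical :: "(nat, 'e) pre_digraph \<Rightarrow> nat \<Rightarrow> int vec \<Rightarrow> bool" where
  "critical G n a \<longleftrightarrow> nonneg_config n a \<and>
     (\<forall>b \<in> carrier_vec n. \<exists>c. nonneg_config n c \<and> nonneg_config n (b + c) \<and>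
        a = stabilization G n (b + c))"

text \<open>The inverse is taken over the rationals; \<open>mat_inverse\<close> returns \<open>Some\<close> inverse exactly for
  invertible matrices, which the reduced Laplacian is whenever \<open>n + 1\<close> is a global sink.\<close>

definition energy :: "(nat, 'e) pre_digraph \<Rightarrow> nat \<Rightarrow> int vec \<Rightarrow> rat vec" where
  "energy G n a =
     row_vec_mult (map_vec of_int a) (the (mat_inverse (map_mat of_int (reduced_laplacian G n))))"

text \<open>The order \<open>\<le>\<close> on vectors of equal dimension is the componentwise one.\<close>

definition cfg_le :: "(nat, 'e) pre_digraph \<Rightarrow> nat \<Rightarrow> int vec \<Rightarrow> int vec \<Rightarrow> bool" where
  "cfg_le G n a b \<longleftrightarrow> energy G n a \<le> energy G n b"

end

theory Submission
  imports Defs "Jordan_Normal_Form.Determinant"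
begin

text \<open>The reduced Laplacian \<open>\<Delta>\<close> obeys a minimum principle, so it is invertible with entrywise
  non-negative inverse, and the energy of a non-negative configuration is non-negative.  Legal
  firing preserves non-negativity and lowers the energy by the firing vector, hence it terminates;
  by the least action principle the resulting stable configuration is unique.

  Let \<open>a\<close> be stable with \<open>a\<^sup>* = a - \<sigma>\<Delta>\<close>.  Criticality, applied to \<open>a\<close> itself, gives
  \<open>c \<ge> 0\<close> such that \<open>a\<^sup>*\<close> is the stabilization of \<open>a + c\<close>, say with firing vector \<open>\<tau>\<close>.  Then
  \<open>c = (\<tau> - \<sigma>)\<Delta>\<close>, so \<open>\<tau> - \<sigma> \<ge> 0\<close>, while firing \<open>\<tau> - \<sigma>\<close> from \<open>a + c\<close> leads to the stable \<open>a\<close>.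
  Least action yields \<open>\<tau> \<le> \<tau> - \<sigma>\<close>, that is \<open>\<sigma> \<le> 0\<close>, and \<open>- \<sigma>\<close> is the difference of the energies.\<close>

section \<open>Products of row vectors and matrices\<close>

lemma dim_row_vec_mult [simp]: "dim_vec (row_vec_mult v A) = dim_col A"
  unfolding row_vec_mult_def by simp

lemma row_vec_mult_carrier [simp]:
  "A \<in> carrier_mat n m \<Longrightarrow> row_vec_mult v A \<in> carrier_vec m"
  by (intro carrier_vecI) simp

lemma row_vec_mult_index:
  assumes "A \<in> carrier_mat n m" "v \<in> carrier_vec n" "j < m"
  shows "row_vec_mult v A $ j = (\<Sum>i<n. v $ i * A $$ (i, j))"
  using assms unfolding row_vec_mult_def
  by (auto simp: scalar_prod_def lessThan_atLeast0 mult.commute intro!: sum.cong)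

lemma row_vec_mult_assoc:
  fixes A B :: "'a :: comm_semiring_0 mat"
  assumes "A \<in> carrier_mat n m" "B \<in> carrier_mat m k" "v \<in> carrier_vec n"
  shows "row_vec_mult (row_vec_mult v A) B = row_vec_mult v (A * B)"
  unfolding row_vec_mult_def transpose_mult[OF assms(1,2)]
  by (rule assoc_mult_mat_vec[symmetric]) (use assms in auto)

lemma row_vec_mult_one:
  fixes v :: "'a :: comm_semiring_1 vec"
  shows "v \<in> carrier_vec n \<Longrightarrow> row_vec_mult v (1\<^sub>m n) = v"
  unfolding row_vec_mult_def by simp

lemma row_vec_mult_zero:
  "A \<in> carrier_mat n m \<Longrightarrow> row_vec_mult (0\<^sub>v n) A = 0\<^sub>v m"
  unfolding row_vec_mult_def by (intro eq_vecI) auto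

lemma row_vec_mult_diff:
  fixes A :: "'a :: comm_ring mat"
  assumes "A \<in> carrier_mat n m" "v \<in> carrier_vec n" "w \<in> carrier_vec n"
  shows "row_vec_mult (v - w) A = row_vec_mult v A - row_vec_mult w A"
  unfolding row_vec_mult_def
  by (rule mult_minus_distrib_mat_vec) (use assms in auto)

lemma of_int_row_vec_mult:
  assumes "A \<in> carrier_mat n m" "v \<in> carrier_vec n"
  shows "map_vec (of_int :: int \<Rightarrow> 'a :: comm_ring_1) (row_vec_mult v A)
    = row_vec_mult (map_vec of_int v) (map_mat of_int A)"
proof (rule eq_vecI)
  fix j assume "j < dim_vec (row_vec_mult (map_vec of_int v) (map_mat (of_int :: int \<Rightarrow> 'a) A))"
  then have j: "j < m" using assms by simp
  then have "map_vec (of_int :: int \<Rightarrow> 'a) (row_vec_mult v A) $ j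
      = of_int (\<Sum>i<n. v $ i * A $$ (i, j))"
    using assms by (simp add: row_vec_mult_index[OF assms])
  also have "\<dots> = row_vec_mult (map_vec of_int v) (map_mat of_int A) $ j"
    using assms j by (subst row_vec_mult_index[of _ n m]) auto
  finally show "map_vec (of_int :: int \<Rightarrow> 'a) (row_vec_mult v A) $ j
    = row_vec_mult (map_vec of_int v) (map_mat of_int A) $ j" .
qed simp

lemma map_vec_of_int_inj:
  assumes "map_vec (of_int :: int \<Rightarrow> 'a :: ring_char_0) v = map_vec of_int w"
  shows "v = w"
proof (rule eq_vecI)
  show dim: "dim_vec v = dim_vec w" using arg_cong[OF assms, of dim_vec] by simp
  fix i assume "i < dim_vec w"
  then show "v $ i = w $ i" using arg_cong[OF assms, of "\<lambda>u. u $ i"] dim by simp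
qed

lemma vec_le_iff:
  assumes "v \<in> carrier_vec n" "w \<in> carrier_vec n"
  shows "v \<le> w \<longleftrightarrow> (\<forall>i<n. v $ i \<le> w $ i)"
  using carrier_vecD[OF assms(1)] carrier_vecD[OF assms(2)] by (simp add: less_eq_vec_def)

lemma nonneg_config_iff:
  "nonneg_config n a \<longleftrightarrow> a \<in> carrier_vec n \<and> (\<forall>i<n. 0 \<le> a $ i)"
  unfolding nonneg_config_def using vec_le_iff[OF zero_carrier_vec, of a n] by auto

section \<open>The reduced Laplacian: minimum principle and inverse\<close>

locale sandpile = fin_digraph G + loopfree_digraph G
  for G :: "(nat, 'e) pre_digraph" +
  fixes n :: nat
  assumes verts_eq: "verts G = {1..n + 1}"
    and sink: "global_sink G (n + 1)"
begin

abbreviation lap :: "int mat" where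
  "lap \<equiv> reduced_laplacian G n"

abbreviation lap_rat :: "rat mat" where
  "lap_rat \<equiv> map_mat of_int lap"

abbreviation lap_inv :: "rat mat" where
  "lap_inv \<equiv> the (mat_inverse lap_rat)"

lemma lap_carrier [simp]: "lap \<in> carrier_mat n n"
  unfolding reduced_laplacian_def by simp

lemma dim_lap [simp]: "dim_row lap = n" "dim_col lap = n"
  unfolding reduced_laplacian_def by simp_all

lemma lap_rat_carrier [simp]: "lap_rat \<in> carrier_mat n n"
  by simp

lemma lap_index:
  "i < n \<Longrightarrow> j < n \<Longrightarrow> lap $$ (i, j) =
    (if i = j then int (out_degree G (i + 1)) else - int (edge_mult G (i + 1) (j + 1)))"
  unfolding reduced_laplacian_def by simp

lemma edge_mult_self [simp]: "edge_mult G i i = 0"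
proof -
  have "{e \<in> arcs G. tail G e = i \<and> head G e = i} = {}" using no_loops by fastforce
  then show ?thesis unfolding edge_mult_def by (simp only: card.empty)
qed

text \<open>Grouping the out-going arcs by their heads lets sums over arcs replace
  multiplicities.\<close>

lemma sum_out_arcs_head:
  fixes f :: "nat \<Rightarrow> rat"
  shows "(\<Sum>e\<in>out_arcs G i. f (head G e)) = (\<Sum>j\<in>verts G. of_nat (edge_mult G i j) * f j)"
proof -
  have "(\<Sum>e\<in>out_arcs G i. f (head G e))
      = (\<Sum>j\<in>verts G. \<Sum>e\<in>{e \<in> out_arcs G i. head G e = j}. f (head G e))"
    by (rule sum.group[symmetric]) (auto simp: out_arcs_def)
  also have "\<dots> = (\<Sum>j\<in>verts G. \<Sum>e\<in>{e \<in> arcs G. tail G e = i \<and> head G e = j}. f j)"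
    by (intro sum.cong) (auto simp: out_arcs_def)
  finally show ?thesis by (simp add: edge_mult_def)
qed

text \<open>The diagonal entry counts the arcs leaving \<open>i + 1\<close>, so it can be spread
  over them, one copy of \<open>y (i + 1)\<close> per arc. The extension \<open>y\<close> of
  \<open>x\<close> is 0 at the sink, which accounts for the arcs into the sink, for which the matrix
  has no column.\<close>

lemma lap_rat_mult_vec_index:
  assumes x: "x \<in> carrier_vec n" and i: "i < n"
  defines "y \<equiv> \<lambda>v. if v \<in> {1..n} then x $ (v - 1) else 0"
  shows "(lap_rat *\<^sub>v x) $ i = (\<Sum>e\<in>out_arcs G (i + 1). y (i + 1) - y (head G e))"
proof -
  have "(lap_rat *\<^sub>v x) $ i = (\<Sum>j<n. of_int (lap $$ (i, j)) * x $ j)"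
    using x i by (auto simp: scalar_prod_def lessThan_atLeast0 reduced_laplacian_def intro!: sum.cong)
  \<comment> \<open>Without loops \<open>edge_mult\<close> vanishes on the diagonal, so both terms
    can be written for every \<open>j\<close>.\<close>
  also have "\<dots> = (\<Sum>j<n. (if i = j then of_nat (out_degree G (i + 1)) * x $ j else 0)
      - of_nat (edge_mult G (i + 1) (j + 1)) * x $ j)"
    using i by (intro sum.cong) (auto simp: lap_index)
  also have "\<dots> = of_nat (out_degree G (i + 1)) * x $ i
      - (\<Sum>j<n. of_nat (edge_mult G (i + 1) (j + 1)) * x $ j)"
    using i by (simp add: sum_subtractf)
  also have "(\<Sum>j<n. of_nat (edge_mult G (i + 1) (j + 1)) * x $ j)
      = (\<Sum>j\<in>{1..n}. of_nat (edge_mult G (i + 1) j) * y j)"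
    by (rule sum.reindex_bij_witness[of _ "\<lambda>j. j - 1" "\<lambda>j. j + 1"]) (auto simp: y_def)
  \<comment> \<open>The additional vertex is the sink, where \<open>y\<close> is 0.\<close>
  also have "\<dots> = (\<Sum>j\<in>verts G. of_nat (edge_mult G (i + 1) j) * y j)"
    by (rule sum.mono_neutral_left) (auto simp: verts_eq y_def)
  also have "\<dots> = (\<Sum>e\<in>out_arcs G (i + 1). y (head G e))"
    by (rule sum_out_arcs_head[symmetric])
  finally show ?thesis
    using i by (simp add: sum_subtractf out_degree_def y_def)
qed

text \<open>At a vertex where the extended function \<open>y\<close> attains a negative minimum, the
  non-negative sum of \<open>y v - y (head G e)\<close> has only non-positive terms. Hence all
  out-neighbours attain the minimum too, and it spreads along a path to the sink, where
  \<open>y\<close> is 0.\<close>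

lemma minimum_principle:
  assumes x: "x \<in> carrier_vec n" and ge: "0\<^sub>v n \<le> lap_rat *\<^sub>v x"
  shows "0\<^sub>v n \<le> x"
proof -
  define y where "y v = (if v \<in> {1..n} then x $ (v - 1) else 0)" for v :: nat
  define m where "m = Min (y ` verts G)"
  have fin: "finite (y ` verts G)" and ne: "y ` verts G \<noteq> {}" by (auto simp: verts_eq)
  have m_le: "m \<le> y v" if "v \<in> verts G" for v
    unfolding m_def using fin that by auto
  have "m \<ge> 0"
  proof (rule ccontr)
    assume "\<not> m \<ge> 0"
    obtain u where u: "u \<in> verts G" "y u = m"
      using Min_in[OF fin ne] unfolding m_def by auto
    have "u \<noteq> n + 1" using u \<open>\<not> m \<ge> 0\<close> by (auto simp: y_def)
    then have "u \<rightarrow>\<^sup>*\<^bsub>G\<^esub> (n + 1)" using sink u unfolding global_sink_def by auto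
    then have "y (n + 1) = m"
    proof (induction rule: reachable_induct)
      case base
      show ?case by (rule u)
    next
      case (step v w)
      then have "v \<in> verts G" using reachable_in_verts by blast
      \<comment> \<open>As \<open>y\<close> is negative at \<open>v\<close>, this vertex is not the
        sink and owns a row of \<open>lap\<close>.\<close>
      moreover have "v \<noteq> n + 1" using step.IH \<open>\<not> m \<ge> 0\<close> by (auto simp: y_def)
      ultimately have v: "v - 1 < n" "v - 1 + 1 = v" by (auto simp: verts_eq)
      obtain e where e: "e \<in> arcs G" "tail G e = v" "head G e = w"
        using step.hyps(2) by blast
      have "0 \<le> (lap_rat *\<^sub>v x) $ (v - 1)"
        using ge v unfolding less_eq_vec_def by auto
      also have "\<dots> = (\<Sum>e\<in>out_arcs G v. y v - y (head G e))"
        using lap_rat_mult_vec_index[OF x v(1)] unfolding v(2) y_def .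
      finally have "(\<Sum>e\<in>out_arcs G v. y (head G e) - y v) \<le> 0"
        by (simp add: sum_subtractf)
      moreover have nn: "0 \<le> y (head G e) - y v" if "e \<in> out_arcs G v" for e
        using that m_le[of "head G e"] step.IH by (auto simp: out_arcs_def)
      ultimately have "(\<Sum>e\<in>out_arcs G v. y (head G e) - y v) = 0"
        by (meson order.antisym sum_nonneg)
      then have "\<forall>e\<in>out_arcs G v. y (head G e) - y v = 0"
        using nn by (subst (asm) sum_nonneg_eq_0_iff) (auto simp: out_arcs_def)
      then show ?case using e step.IH by (auto simp: out_arcs_def)
    qed
    then show False using \<open>\<not> m \<ge> 0\<close> by (simp add: y_def)
  qed
  moreover have "m \<le> x $ i" if "i < n" for i
    using m_le[of "i + 1"] that by (simp add: verts_eq y_def)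
  ultimately show ?thesis using x unfolding less_eq_vec_def by fastforce
qed

text \<open>The minimum principle applies to a kernel vector and to its negative, so the kernel is
  trivial and the determinant is nonzero.\<close>

lemma lap_inverse:
  shows "lap_rat * lap_inv = 1\<^sub>m n" and "lap_inv * lap_rat = 1\<^sub>m n"
    and lap_inv_carrier [simp]: "lap_inv \<in> carrier_mat n n"
proof -
  have "v = 0\<^sub>v n" if v: "v \<in> carrier_vec n" and 0: "lap_rat *\<^sub>v v = 0\<^sub>v n" for v
  proof -
    have "lap_rat *\<^sub>v (- v) = - (lap_rat *\<^sub>v v)"
      by (rule eq_vecI) (use v in auto)
    then have "0\<^sub>v n \<le> v" "0\<^sub>v n \<le> - v"
      using minimum_principle[of v] minimum_principle[of "- v"] v 0 by auto
    then show ?thesis using v by (intro eq_vecI) (auto simp: less_eq_vec_def intro: order.antisym)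
  qed
  then have "det lap_rat \<noteq> 0"
    using det_0_iff_vec_prod_zero_field[OF lap_rat_carrier] by blast
  then have "lap_rat \<in> Units (ring_mat TYPE(rat) n ())"
    by (rule det_non_zero_imp_unit[OF lap_rat_carrier])
  then obtain B where B: "mat_inverse lap_rat = Some B"
    using mat_inverse(1)[OF lap_rat_carrier, where b = "()"] by fastforce
  show "lap_rat * lap_inv = 1\<^sub>m n" "lap_inv * lap_rat = 1\<^sub>m n" "lap_inv \<in> carrier_mat n n"
    using mat_inverse(2)[OF lap_rat_carrier B] B by auto
qed

lemma dim_lap_inv [simp]: "dim_row lap_inv = n" "dim_col lap_inv = n"
  using lap_inv_carrier by blast+

text \<open>\<open>lap_rat\<close> maps each column of the inverse to a unit vector, which is
  non-negative, so the minimum principle applies to that column.\<close>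

lemma lap_inv_nonneg:
  assumes "i < n" "j < n"
  shows "0 \<le> lap_inv $$ (i, j)"
proof -
  have "lap_rat *\<^sub>v col lap_inv j = col (lap_rat * lap_inv) j"
    using assms by (intro col_mult2[symmetric]) auto
  also have "\<dots> = unit_vec n j" using assms by (simp add: lap_inverse)
  finally have *: "lap_rat *\<^sub>v col lap_inv j = unit_vec n j" .
  have "0\<^sub>v n \<le> col lap_inv j"
  proof (rule minimum_principle)
    show "col lap_inv j \<in> carrier_vec n" by (intro carrier_vecI) simp
    show "0\<^sub>v n \<le> lap_rat *\<^sub>v col lap_inv j"
      unfolding * by (simp add: less_eq_vec_def unit_vec_def)
  qed
  then show ?thesis
    using assms by (simp add: less_eq_vec_def)
qed

section \<open>Energy vectors\<close>

lemma dim_energy [simp]: "dim_vec (energy G n a) = n"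
  unfolding energy_def by simp

lemma energy_carrier [simp]: "energy G n a \<in> carrier_vec n"
  by (intro carrier_vecI) simp

lemma energy_nonneg:
  assumes "nonneg_config n a"
  shows "0\<^sub>v n \<le> energy G n a"
proof -
  have "0 \<le> energy G n a $ j" if "j < n" for j
  proof -
    have a: "map_vec rat_of_int a \<in> carrier_vec n" "\<And>i. i < n \<Longrightarrow> 0 \<le> a $ i"
      using assms by (auto simp: nonneg_config_iff)
    show ?thesis
      unfolding energy_def row_vec_mult_index[OF lap_inv_carrier a(1) that]
      using a that by (intro sum_nonneg mult_nonneg_nonneg lap_inv_nonneg) auto
  qed
  then show ?thesis by (auto simp: less_eq_vec_def)
qed

lemma energy_row_vec_mult:
  assumes "s \<in> carrier_vec n"
  shows "energy G n (row_vec_mult s lap) = map_vec of_int s"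
  unfolding energy_def of_int_row_vec_mult[OF lap_carrier assms] using assms
  by (simp add: row_vec_mult_assoc[OF lap_rat_carrier lap_inv_carrier] lap_inverse
      row_vec_mult_one)

lemma energy_diff:
  assumes "a \<in> carrier_vec n" "b \<in> carrier_vec n"
  shows "energy G n (a - b) = energy G n a - energy G n b"
proof -
  have "map_vec rat_of_int (a - b) = map_vec of_int a - map_vec of_int b"
    by (rule eq_vecI) (use assms in auto)
  then show ?thesis
    unfolding energy_def using assms by (simp add: row_vec_mult_diff[OF lap_inv_carrier])
qed

lemma energy_minus_row_vec_mult:
  assumes "a \<in> carrier_vec n" "s \<in> carrier_vec n"
  shows "energy G n (a - row_vec_mult s lap) = energy G n a - map_vec of_int s"
  using assms by (simp add: energy_diff energy_row_vec_mult row_vec_mult_carrier[OF lap_carrier])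

text \<open>Multiplying the energy by \<open>lap_rat\<close> recovers the configuration. This gives
  strictness for distinct configurations.\<close>

lemma energy_inj:
  assumes "a \<in> carrier_vec n" "b \<in> carrier_vec n" "energy G n a = energy G n b"
  shows "a = b"
proof -
  have "row_vec_mult (energy G n c) lap_rat = map_vec of_int c" if "c \<in> carrier_vec n" for c
    using that unfolding energy_def
    by (simp add: row_vec_mult_assoc[OF lap_inv_carrier lap_rat_carrier] lap_inverse
        row_vec_mult_one)
  then have "map_vec rat_of_int a = map_vec of_int b" using assms by metis
  then show ?thesis by (rule map_vec_of_int_inj)
qed

section \<open>Firing vectors of legal sequences\<close>

definition fire_count :: "nat list \<Rightarrow> int vec" where
  "fire_count is = vec n (\<lambda>k. int (count_list is (k + 1)))"

lemma dim_fire_count [simp]: "dim_vec (fire_count is) = n"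
  unfolding fire_count_def by simp

lemma fire_count_carrier [simp]: "fire_count is \<in> carrier_vec n"
  by (intro carrier_vecI) simp

lemma fire_index:
  assumes "a \<in> carrier_vec n" "i \<in> {1..n}" "j < n"
  shows "fire G n a i $ j = a $ j - lap $$ (i - 1, j)"
  using assms unfolding fire_def by auto

lemma dim_fire [simp]: "dim_vec (fire G n a i) = n"
  unfolding fire_def by simp

lemma fire_carrier [simp]: "fire G n a i \<in> carrier_vec n"
  by (intro carrier_vecI) simp

lemma row_vec_mult_unit:
  assumes "i < n"
  shows "row_vec_mult (unit_vec n i) lap = row lap i"
  using assms unfolding row_vec_mult_def
  by (intro eq_vecI) auto

text \<open>Splits one firing of \<open>i\<close> off a firing vector; this is the induction step
  for \<open>foldl_fire\<close> and \<open>least_action\<close>.\<close>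

lemma minus_row_vec_mult_fire:
  assumes a: "a \<in> carrier_vec n" and s: "s \<in> carrier_vec n" and i: "i \<in> {1..n}"
  shows "a - row_vec_mult s lap = fire G n a i - row_vec_mult (s - unit_vec n (i - 1)) lap"
proof -
  have i': "i - 1 < n" using i by auto
  show ?thesis
    unfolding fire_def row_vec_mult_diff[OF lap_carrier s unit_vec_carrier]
      row_vec_mult_unit[OF i']
    by (rule eq_vecI) (use a in auto)
qed

lemma fire_count_Cons:
  assumes "i \<in> {1..n}"
  shows "fire_count (i # is) - unit_vec n (i - 1) = fire_count is"
  using assms unfolding fire_count_def by (intro eq_vecI) (auto simp: unit_vec_def)

lemma foldl_fire:
  "a \<in> carrier_vec n \<Longrightarrow> legal_seq G n a is \<Longrightarrow>
    foldl (fire G n) a is = a - row_vec_mult (fire_count is) lap"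
proof (induction "is" arbitrary: a)
  case Nil
  have "fire_count [] = 0\<^sub>v n" unfolding fire_count_def by auto
  then show ?case using Nil by (simp add: row_vec_mult_zero[OF lap_carrier])
next
  case (Cons i "is")
  then show ?case
    using minus_row_vec_mult_fire[of a "fire_count (i # is)" i] fire_count_Cons[of i "is"]
    by simp
qed

text \<open>An active vertex can afford its out-degree, and every other vertex only gains.\<close>

lemma legal_seq_nonneg:
  "nonneg_config n a \<Longrightarrow> legal_seq G n a is \<Longrightarrow> nonneg_config n (foldl (fire G n) a is)"
proof (induction "is" arbitrary: a)
  case (Cons i "is")
  then have i: "i \<in> {1..n}" and a: "a \<in> carrier_vec n" and act: "active G a i"
    by (auto simp: nonneg_config_def)
  have "0 \<le> fire G n a i $ j" if "j < n" for j
  proof (cases "j = i - 1")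
    case True
    then show ?thesis
      using fire_index[OF a i that] lap_index[of "i - 1" j] that i act by (auto simp: active_def)
  next
    case False
    then show ?thesis
      using fire_index[OF a i that] lap_index[of "i - 1" j] that i Cons.prems(1)
      by (auto simp: nonneg_config_iff)
  qed
  then have "nonneg_config n (fire G n a i)"
    by (auto simp: nonneg_config_iff)
  then show ?case using Cons by simp
qed simp

text \<open>The energy drops by exactly the firing vector and stays non-negative, so the initial
  energy bounds each firing count.\<close>

lemma length_legal_seq:
  assumes a: "nonneg_config n a" and legal: "legal_seq G n a is"
  shows "rat_of_nat (length is) \<le> (\<Sum>k<n. energy G n a $ k)"
proof -
  have "set is \<subseteq> {1..n}" using legal by (induction "is" arbitrary: a) auto
  then have "length is = (\<Sum>v\<in>{1..n}. count_list is v)"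
    using sum_count_set[of "is" "{1..n}"] by simp
  also have "\<dots> = (\<Sum>k<n. count_list is (k + 1))"
    by (rule sum.reindex_bij_witness[of _ "\<lambda>j. j + 1" "\<lambda>j. j - 1"]) auto
  finally have "rat_of_nat (length is) = (\<Sum>k<n. of_int (fire_count is $ k))"
    by (simp add: fire_count_def)
  also have "\<dots> \<le> (\<Sum>k<n. energy G n a $ k)"
  proof (rule sum_mono)
    fix k assume "k \<in> {..<n}"
    have car: "a \<in> carrier_vec n" using a by (simp add: nonneg_config_def)
    have "0\<^sub>v n \<le> energy G n a - map_vec of_int (fire_count is)"
      using energy_nonneg[OF legal_seq_nonneg[OF a legal]] foldl_fire[OF car legal]
        energy_minus_row_vec_mult[OF car, of "fire_count is"] by simp
    then show "of_int (fire_count is $ k) \<le> energy G n a $ k"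
      using \<open>k \<in> {..<n}\<close> by (auto simp: less_eq_vec_def)
  qed
  finally show ?thesis .
qed

section \<open>Existence and uniqueness of the stabilization\<close>

lemma legal_seq_snoc:
  "legal_seq G n a (is @ [i])
    \<longleftrightarrow> legal_seq G n a is \<and> i \<in> {1..n} \<and> active G (foldl (fire G n) a is) i"
  by (induction "is" arbitrary: a) auto

text \<open>Legal sequences have bounded length, and one of maximal length ends without active
  vertices, since otherwise it could be extended.\<close>

lemma stable_reachable:
  assumes a: "nonneg_config n a"
  shows "\<exists>s. stable_config G n s \<and> legally_reachable G n a s"
proof -
  have "length is \<le> nat \<lceil>\<Sum>k<n. energy G n a $ k\<rceil>" if "legal_seq G n a is" for "is"
    using length_legal_seq[OF a that] by linarith
  then have "\<exists>is. legal_seq G n a is \<and> (\<forall>js. legal_seq G n a js \<longrightarrow> length js \<le> length is)"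
    \<comment> \<open>The empty sequence is legal, and the \<open>+ 1\<close> makes the bound
      strict.\<close>
    by (intro ex_has_greatest_nat[where k = "[]" and b = "nat \<lceil>\<Sum>k<n. energy G n a $ k\<rceil> + 1"])
      (auto simp: less_Suc_eq_le)
  then obtain "is" where legal: "legal_seq G n a is"
    and longest: "\<And>js. legal_seq G n a js \<Longrightarrow> length js \<le> length is"
    by blast
  have "\<not> active G (foldl (fire G n) a is) i" if "i \<in> {1..n}" for i
    using longest[of "is @ [i]"] legal that by (auto simp: legal_seq_snoc)
  then show ?thesis
    using legal legal_seq_nonneg[OF a legal]
    unfolding stable_config_def legally_reachable_def by blast
qed

text \<open>The vector \<open>t\<close> may come from an arbitrary, possibly illegal, way of firing.
  If it omitted the first fired vertex \<open>i\<close>, the other firings could only add to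
  \<open>i\<close> and leave it active at the end. So \<open>t\<close> contains \<open>i\<close>,
  and one firing of \<open>i\<close> is removed from both sides.\<close>

lemma least_action:
  assumes "a \<in> carrier_vec n" "legal_seq G n a is"
    and "t \<in> carrier_vec n" "0\<^sub>v n \<le> t"
    and "\<And>i. i \<in> {1..n} \<Longrightarrow> \<not> active G (a - row_vec_mult t lap) i"
  shows "fire_count is \<le> t"
  using assms
proof (induction "is" arbitrary: a t)
  case Nil
  then show ?case by (auto simp: fire_count_def less_eq_vec_def)
next
  case (Cons i "is")
  then have i: "i \<in> {1..n}" and act: "active G a i" by auto
  then have i': "i - 1 < n" by auto
  let ?t = "t - unit_vec n (i - 1)"
  have "t $ (i - 1) \<noteq> 0"
  proof
    assume 0: "t $ (i - 1) = 0"
    have "row_vec_mult t lap $ (i - 1) = (\<Sum>k<n. t $ k * lap $$ (k, i - 1))"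
      by (rule row_vec_mult_index[OF lap_carrier Cons.prems(3) i'])
    \<comment> \<open>The diagonal term vanishes by \<open>0\<close>; all other entries of the
      column are non-positive.\<close>
    also have "\<dots> \<le> 0"
      using Cons.prems(3,4) 0 i'
      by (intro sum_nonpos)
        (auto simp: lap_index less_eq_vec_def mult_le_0_iff)
    finally have "active G (a - row_vec_mult t lap) i"
      using act i' Cons.prems(1)
      by (auto simp: active_def)
    then show False using Cons.prems(5) i by blast
  qed
  then have "0\<^sub>v n \<le> ?t"
    using Cons.prems(3,4) i' by (fastforce simp: less_eq_vec_def unit_vec_def)
  moreover have "\<not> active G (fire G n a i - row_vec_mult ?t lap) j" if "j \<in> {1..n}" for j
    using Cons.prems(5)[OF that] minus_row_vec_mult_fire[OF Cons.prems(1,3) i] by simp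
  ultimately have "fire_count is \<le> ?t"
    using Cons.prems by (intro Cons.IH[of "fire G n a i"]) auto
  then have "fire_count (i # is) - unit_vec n (i - 1) \<le> ?t"
    unfolding fire_count_Cons[OF i] .
  then show ?case
    using Cons.prems(3) by (auto simp: less_eq_vec_def)
qed

text \<open>By least action, each of the two firing vectors is below the other.\<close>

lemma stable_reachable_unique:
  assumes a: "a \<in> carrier_vec n"
    and s: "stable_config G n s" "legally_reachable G n a s"
    and t: "stable_config G n t" "legally_reachable G n a t"
  shows "s = t"
proof -
  obtain "is" js where legal: "legal_seq G n a is" "legal_seq G n a js"
    and st: "s = a - row_vec_mult (fire_count is) lap" "t = a - row_vec_mult (fire_count js) lap"
    using s t foldl_fire[OF a] unfolding legally_reachable_def by metis
  have nonneg: "0\<^sub>v n \<le> fire_count ks" for ks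
    by (auto simp: fire_count_def less_eq_vec_def)
  have "fire_count is \<le> fire_count js" "fire_count js \<le> fire_count is"
    using s(1) t(1) st by (auto intro!: least_action[OF a] legal nonneg simp: stable_config_def)
  then show ?thesis using st by (metis order.antisym)
qed

text \<open>Justifies the definite description in the definition of
  \<open>stabilization\<close>.\<close>

lemma stabilization:
  assumes "nonneg_config n a"
  shows "stable_config G n (stabilization G n a)"
    and "legally_reachable G n a (stabilization G n a)"
proof -
  have "\<exists>!s. stable_config G n s \<and> legally_reachable G n a s"
    using stable_reachable[OF assms] stable_reachable_unique assms
    unfolding nonneg_config_def by blast
  from theI'[OF this]
  show "stable_config G n (stabilization G n a)" "legally_reachable G n a (stabilization G n a)"
    unfolding stabilization_def by auto
qed

section \<open>Critical configurations and maximal energy\<close>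

lemma critical_stable:
  assumes "critical G n a"
  shows "stable_config G n a"
  \<comment> \<open>Criticality is tested on the zero configuration; any other would do.\<close>
  using assms stabilization(1) unfolding critical_def by (metis zero_carrier_vec)

lemma lin_equiv_refl:
  assumes "a \<in> carrier_vec n"
  shows "lin_equiv G n a a"
  unfolding lin_equiv_def using assms
  by (intro conjI bexI[of _ "0\<^sub>v n"]) (auto simp: row_vec_mult_zero[OF lap_carrier])

lemma energy_le_critical:
  assumes crit: "critical G n a_star" and stab: "stable_config G n a"
    and equiv: "lin_equiv G n a a_star"
  shows "energy G n a \<le> energy G n a_star"
proof -
  obtain s where a: "a \<in> carrier_vec n" and s: "s \<in> carrier_vec n"
    and a_star: "a_star = a - row_vec_mult s lap"
    using equiv unfolding lin_equiv_def by blast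
  \<comment> \<open>The configuration \<open>b\<close> of criticality is chosen to be
    \<open>a\<close> itself.\<close>
  obtain c where c: "nonneg_config n c" and ac: "nonneg_config n (a + c)"
    and st: "a_star = stabilization G n (a + c)"
    using crit a unfolding critical_def by blast
  have c': "c \<in> carrier_vec n" and ac': "a + c \<in> carrier_vec n"
    using c ac by (auto simp: nonneg_config_def)
  obtain "is" where legal: "legal_seq G n (a + c) is" and "a_star = foldl (fire G n) (a + c) is"
    using stabilization(2)[OF ac, folded st] unfolding legally_reachable_def by blast
  then have fired: "a_star = a + c - row_vec_mult (fire_count is) lap"
    using foldl_fire[OF ac' legal] by simp
  let ?t = "fire_count is - s"
  have t: "?t \<in> carrier_vec n" using s by simp
  \<comment> \<open>Coordinatewise comparison of the two expressions \<open>a_star\<close> and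
    \<open>fired\<close> for the critical configuration.\<close>
  have rt: "row_vec_mult ?t lap = c"
  proof (rule eq_vecI)
    show "dim_vec (row_vec_mult ?t lap) = dim_vec c"
      using c' by simp
    fix j assume "j < dim_vec c"
    then show "row_vec_mult ?t lap $ j = c $ j"
      using arg_cong[OF a_star[unfolded fired], of "\<lambda>v. v $ j"] a c'
        row_vec_mult_diff[OF lap_carrier fire_count_carrier s, of "is"]
      by simp
  qed
  have "energy G n c = map_vec of_int ?t"
    using energy_row_vec_mult[OF t] unfolding rt .
  then have "0\<^sub>v n \<le> ?t"
    using energy_nonneg[OF c] s by (simp add: less_eq_vec_def flip: of_int_diff)
  \<comment> \<open>Firing \<open>?t\<close> takes away exactly \<open>c\<close>. No legal sequence
    with firing vector \<open>?t\<close> is at hand, so the generality of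
    \<open>least_action\<close> matters.\<close>
  moreover have "a + c - row_vec_mult ?t lap = a"
    unfolding rt using a c' by (intro eq_vecI) auto
  ultimately have "fire_count is \<le> ?t"
    using stab by (intro least_action[OF ac' legal t]) (auto simp: stable_config_def)
  then have "s $ k \<le> 0" if "k < n" for k
    using that s by (auto simp: less_eq_vec_def)
  moreover have "energy G n a_star = energy G n a - map_vec of_int s"
    unfolding a_star by (rule energy_minus_row_vec_mult[OF a s])
  ultimately show ?thesis
    using s by (auto simp: less_eq_vec_def)
qed

end

theorem theorem3:
  fixes G :: "(nat, 'e) pre_digraph" and n :: nat and a_star :: "int vec"
  assumes "fin_digraph G" and "loopfree_digraph G"
    and "verts G = {1..n + 1}"
    and "global_sink G (n + 1)"
    and "critical G n a_star"
  shows "stable_config G n a_star \<and> lin_equiv G n a_star a_star \<and>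
    (\<forall>a. stable_config G n a \<and> lin_equiv G n a a_star \<longrightarrow>
       cfg_le G n a a_star \<and>
       (a \<noteq> a_star \<longrightarrow> energy G n a \<noteq> energy G n a_star))"
proof -
  interpret fin_digraph G by fact
  interpret loopfree_digraph G by fact
  interpret sandpile G n by unfold_locales (fact assms(3), fact assms(4))
  have "a_star \<in> carrier_vec n"
    using assms(5) by (simp add: critical_def nonneg_config_def)
  \<comment> \<open>\<open>critical_stable\<close> and \<open>lin_equiv_refl\<close> place
    \<open>a_star\<close> among the stable members of its class, so it is a maximum and not only an
    upper bound.\<close>
  then show ?thesis
    using critical_stable[OF assms(5)] lin_equiv_refl energy_le_critical[OF assms(5)] energy_inj
    unfolding cfg_le_def lin_equiv_def by blast
qed

end
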